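(* Let $N$ be a positive integer with $2N\geq 3\times 10^{6}$. Then $\operatorname{card}X_{2N}>\operatorname{card}P_{2N}$.
   Context: For a positive integer $N$, a prime of type P related to $2N$ is a prime $p$ with $p<2N-2$ and $p\nmid 2N$. $P_{2N}$ denotes the set of primes of type P related to $2N$. A composite of type P related to $2N$ is a composite integer $x<2N-2$ all of whose prime factors are primes of type P related to $2N$ (equivalently, a composite $x<2N-2$ with $\gcd(x,2N)=1$). $X_{2N}$ denotes the set of composites of type P related to $2N$. *)

theory Defs
  imports "HOL-Computational_Algebra.Primes"
begin

definition P_set :: "nat \<Rightarrow> nat set" where
  "P_set N = {p. prime p \<and> p < 2 * N - 2 \<and> \<not> p dvd 2 * N}"

definition X_set :: "nat \<Rightarrow> nat set" where
  "X_set N = {x. x > 1 \<and> \<not> prime x \<and> x < 2 * N - 2 \<and> prime_factors x \<subseteq> P_set N}"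

end

theory Submission
  imports Defs "HOL-Number_Theory.Totient" "HOL-Analysis.Complex_Transcendental"
begin

text \<open>
  The numbers coprime to \<open>n = 2 N\<close> below \<open>n\<close> are \<open>1\<close>, \<open>n - 1\<close> and the elements of the two sets, so it
  suffices that \<open>2 \<pi>(n) < \<phi>(n)\<close>. The primes in \<open>(n, 6 n]\<close> all divide the trinomial coefficient
  \<open>(6 n)! / ((3 n)! (2 n)! n!) \<le> 432 ^ n\<close>; iterating gives \<open>\<theta>(x) \<le> 1.22 x + O(1)\<close>, and partial
  summation gives \<open>\<pi>(x) \<le> 1.344 x / ln x\<close> for \<open>x \<ge> 3000000\<close>. On the other side
  \<open>\<phi>(n) \<ge> 2.689 n / ln n\<close>: with at most seven prime factors, \<open>\<phi>(n) / n\<close> is at least its value at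
  \<open>2 \<cdot> 3 \<cdot> 5 \<cdot> 7 \<cdot> 11 \<cdot> 13 \<cdot> 17\<close>, and with eight or more, \<open>(\<phi>(n) / n) ln n\<close> is smallest for the product of
  the first eight primes.
\<close>

section \<open>Chebyshev's function and its trivial bound\<close>

definition primes_upto :: "nat \<Rightarrow> nat set" where
  "primes_upto n = {p. prime p \<and> p \<le> n}"

definition theta :: "nat \<Rightarrow> real" where
  "theta n = (\<Sum>p\<in>primes_upto n. ln (real p))"

lemma finite_primes_upto [simp]: "finite (primes_upto n)"
  by (simp add: primes_upto_def)

lemma primes_upto_Suc:
  "primes_upto (Suc n) = (if prime (Suc n) then insert (Suc n) (primes_upto n) else primes_upto n)"
  by (auto simp: primes_upto_def le_Suc_eq)

lemma Suc_notin_primes_upto [simp]: "Suc n \<notin> primes_upto n"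
  by (simp add: primes_upto_def)

lemma card_primes_upto_le: "card (primes_upto n) \<le> n"
proof -
  have "primes_upto n \<subseteq> {0<..n}"
    by (auto simp: primes_upto_def prime_gt_0_nat)
  from card_mono[OF _ this] show ?thesis by simp
qed

lemma theta_mono: "m \<le> n \<Longrightarrow> theta m \<le> theta n"
  unfolding theta_def
  by (rule sum_mono2) (auto simp: primes_upto_def prime_ge_1_nat)

lemma theta_le_trivial: "theta n \<le> real n * ln (real n)"
proof (cases "n = 0")
  case True
  thus ?thesis by (auto simp: theta_def primes_upto_def)
next
  case False
  have "theta n \<le> (\<Sum>p\<in>primes_upto n. ln (real n))"
    unfolding theta_def
    by (intro sum_mono ln_mono) (auto simp: primes_upto_def prime_gt_0_nat)
  also have "\<dots> = real (card (primes_upto n)) * ln (real n)" by simp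
  also have "\<dots> \<le> real n * ln (real n)"
    using card_primes_upto_le[of n] False by (intro mult_right_mono) auto
  finally show ?thesis .
qed

section \<open>Primes dividing the trinomial coefficient\<close>

lemma prod_primes_dvd:
  fixes m :: nat
  assumes "finite S" and "\<And>p. p \<in> S \<Longrightarrow> prime p" and "\<And>p. p \<in> S \<Longrightarrow> p dvd m"
  shows "\<Prod>S dvd m"
  using assms
proof (induction S rule: finite_induct)
  case (insert q S)
  have "coprime q (\<Prod>S)"
    using insert by (intro prod_coprime_right) (metis insertCI primes_coprime)
  then show ?case using insert by (simp add: divides_mult)
qed simp

text \<open>One step of Legendre's formula: the multiples of \<open>p\<close> up to
  \<open>m\<close>, divided by \<open>p\<close>, are the numbers from 1 to \<open>m div p\<close>.
  The recursive form avoids a sum over the powers of \<open>p\<close>.\<close>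

lemma multiplicity_fact:
  fixes p :: nat
  assumes "prime p"
  shows "multiplicity p (fact m) = m div p + multiplicity p (fact (m div p))"
proof (induction m)
  case 0
  then show ?case by simp
next
  case (Suc m)
  have p: "prime_elem p" and p1: "p > 1" using assms prime_gt_1_nat by blast+
  have *: "multiplicity p (fact (Suc m)) = multiplicity p (Suc m) + multiplicity p (fact m)"
    unfolding fact_Suc of_nat_id using p by (intro prime_elem_multiplicity_mult_distrib) auto
  show ?case
  proof (cases "p dvd Suc m")
    case True
    then obtain k where k: "Suc m = p * k" by blast
    with p1 obtain j where j: "k = Suc j" by (cases k) auto
    have d: "m div p = j" "Suc m div p = Suc j"
    proof -
      show "Suc m div p = Suc j" using k j p1 by simp
      show "m div p = j" using k j p1 by (intro div_nat_eqI) (auto simp: algebra_simps)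
    qed
    have "multiplicity p (Suc m) = Suc (multiplicity p (Suc j))"
      unfolding k j using p1 by (intro multiplicity_times_same) auto
    moreover have "multiplicity p (fact (Suc j)) = multiplicity p (Suc j) + multiplicity p (fact j)"
      unfolding fact_Suc of_nat_id using p by (intro prime_elem_multiplicity_mult_distrib) auto
    ultimately show ?thesis using * Suc d by simp
  next
    case False
    then have "Suc m div p = m div p" by (simp add: div_Suc dvd_eq_mod_eq_0)
    moreover have "multiplicity p (Suc m) = 0" using False by (rule not_dvd_imp_multiplicity_0)
    ultimately show ?thesis using * Suc by simp
  qed
qed

lemma fact_trinomial:
  "(((6 * n) choose (3 * n)) * ((3 * n) choose n)) * (fact (3 * n) * (fact (2 * n) * fact n)) = (fact (6 * n) :: nat)"
proof -
  have 1: "fact (3 * n) * fact (3 * n) * ((6 * n) choose (3 * n)) = (fact (6 * n) :: nat)"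
    using binomial_fact_lemma[of "3 * n" "6 * n"] by simp
  have 2: "fact n * fact (2 * n) * ((3 * n) choose n) = (fact (3 * n) :: nat)"
    using binomial_fact_lemma[of "n" "3 * n"] by simp
  have "(((6 * n) choose (3 * n)) * ((3 * n) choose n)) * (fact (3 * n) * (fact (2 * n) * fact n))
     = ((6 * n) choose (3 * n)) * fact (3 * n) * (fact n * fact (2 * n) * ((3 * n) choose n))"
    by (simp add: mult_ac)
  also have "\<dots> = fact (6 * n)" unfolding 2 using 1 by (simp add: mult_ac)
  finally show ?thesis .
qed

text \<open>For y = n/p in [1/6, 1), floor(6y) exceeds floor(3y) + floor(2y), so \<open>p\<close>
  occurs more often in (6n)! than in (3n)! (2n)! n!.\<close>

lemma prime_dvd_trinomial:
  fixes p :: nat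
  assumes p: "prime p" and "n < p" "p \<le> 6 * n"
  shows "p dvd ((6 * n) choose (3 * n)) * ((3 * n) choose n)" (is "p dvd ?M")
proof -
  have pe: "prime_elem p" using p by simp
  have M: "?M \<noteq> 0" by simp
  define q2 q3 q6 where q: "q2 = (2 * n) div p" "q3 = (3 * n) div p" "q6 = (6 * n) div p"
  have p0: "p > 0" using assms by simp
  have le: "p * q2 \<le> 2 * n" "p * q3 \<le> 3 * n" unfolding q by (simp_all)
  have up: "2 * n < p * Suc q2" "3 * n < p * Suc q3" "6 * n < p * Suc q6"
    unfolding q using p0 by (simp_all add: dividend_less_times_div)
  have "q2 < 2" "q3 < 3" unfolding q using assms p0 by (simp_all add: div_less_iff_less_mult)
  then have cases: "q2 = 0 \<or> q2 = 1" "q3 = 0 \<or> q3 = 1 \<or> q3 = 2" by auto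
  have gt: "q3 + q2 < q6"
  \<comment> \<open>Otherwise 6n < p (q2 + q3 + 1), which is refuted for each of the possible values
    of \<open>q2\<close> and \<open>q3\<close>.\<close>
  proof (rule ccontr)
    assume "\<not> ?thesis"
    then have "p * Suc q6 \<le> p * (Suc (q3 + q2))" by (intro mult_left_mono) auto
    with up(3) have "6 * n < p * (Suc (q3 + q2))" by (rule less_le_trans)
    then show False using cases le up(1,2) assms(2,3) by (elim disjE) simp_all
  qed
  have "multiplicity p (fact (6 * n) :: nat) = multiplicity p ?M + (multiplicity p (fact (3 * n) :: nat)
      + (multiplicity p (fact (2 * n) :: nat) + multiplicity p (fact n :: nat)))"
    unfolding fact_trinomial[of n, symmetric] using pe M
    by (simp add: prime_elem_multiplicity_mult_distrib)
  moreover have "multiplicity p (fact (6 * n) :: nat) = q6 + multiplicity p (fact q6 :: nat)"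
    "multiplicity p (fact (3 * n) :: nat) = q3 + multiplicity p (fact q3 :: nat)"
    "multiplicity p (fact (2 * n) :: nat) = q2 + multiplicity p (fact q2 :: nat)"
    unfolding q by (rule multiplicity_fact[OF p])+
  moreover have "multiplicity p (fact n :: nat) = 0"
    using assms(2) p by (intro not_dvd_imp_multiplicity_0) (simp add: prime_dvd_fact_iff)
  moreover have "multiplicity p (fact q2 :: nat) = 0" using cases(1) by auto
  \<comment> \<open>This accounts for the higher powers of \<open>p\<close>, so that only the
    first-order terms remain to be compared.\<close>
  moreover have "multiplicity p (fact q3 :: nat) \<le> multiplicity p (fact q6 :: nat)"
    using gt by (intro dvd_imp_multiplicity_le fact_dvd) auto
  ultimately have "multiplicity p ?M > 0" using gt by linarith
  then show ?thesis using not_dvd_imp_multiplicity_0 by (metis less_irrefl)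
qed

text \<open>Here 432 = 64 * 27/4: the first factor is at most 2^(6n), and the second, weighted by
  2^(2n), is a single term in the expansion of (1 + 2)^(3n).\<close>

lemma trinomial_le: "real (((6 * n) choose (3 * n)) * ((3 * n) choose n)) \<le> 432 ^ n"
proof -
  have 1: "real ((6 * n) choose (3 * n)) \<le> 64 ^ n"
  proof -
    have "(6 * n) choose (3 * n) \<le> 2 ^ (6 * n)" by (rule binomial_le_pow2)
    also have "\<dots> = (64::nat) ^ n" by (simp add: power_mult)
    finally show ?thesis using of_nat_le_iff[where ?'a = real] by fastforce
  qed
  have 2: "real ((3 * n) choose n) * 4 ^ n \<le> 27 ^ n"
  proof -
    have "real ((3 * n) choose n) * 4 ^ n = (\<Sum>k\<in>{n}. real ((3 * n) choose k) * 1 ^ k * 2 ^ (3 * n - k))"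
      by (simp add: power_mult)
    also have "\<dots> \<le> (\<Sum>k\<le>3 * n. real ((3 * n) choose k) * 1 ^ k * 2 ^ (3 * n - k))"
      by (intro sum_mono2) auto
    also have "\<dots> = (1 + 2) ^ (3 * n)" by (rule binomial_ring [symmetric])
    also have "\<dots> = 27 ^ n" by (simp add: power_mult)
    finally show ?thesis .
  qed
  have "real (((6 * n) choose (3 * n)) * ((3 * n) choose n)) \<le> 64 ^ n * (27 ^ n / 4 ^ n)"
    unfolding of_nat_mult using 1 2 by (intro mult_mono) (auto simp: field_simps)
  also have "\<dots> = (64 * (27 / 4)) ^ n" by (simp only: power_divide power_mult_distrib)
  finally show ?thesis by simp
qed

lemma theta_6_diff_le: "theta (6 * n) - theta n \<le> real n * ln 432"
proof -
  let ?S = "primes_upto (6 * n) - primes_upto n"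
  let ?M = "((6 * n) choose (3 * n)) * ((3 * n) choose n)"
  have sub: "primes_upto n \<subseteq> primes_upto (6 * n)" by (auto simp: primes_upto_def)
  have "\<Prod>?S dvd ?M"
    by (rule prod_primes_dvd) (auto simp: primes_upto_def intro: prime_dvd_trinomial)
  then have le: "\<Prod>?S \<le> ?M" by (rule dvd_imp_le) simp
  have pos: "\<And>p. p \<in> ?S \<Longrightarrow> p > 0" by (auto simp: primes_upto_def prime_gt_0_nat)
  have "theta (6 * n) - theta n = (\<Sum>p\<in>?S. ln (real p))"
    unfolding theta_def using sub by (simp add: sum_diff)
  also have "\<dots> = ln (real (\<Prod>?S))"
    using pos by (subst of_nat_prod, subst ln_prod) (auto simp del: Diff_iff)
  also have "\<dots> \<le> ln (432 ^ n)"
  proof -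
    have "real (\<Prod>?S) \<le> 432 ^ n" using le trinomial_le[of n] by (meson of_nat_le_iff order_trans)
    moreover have "real (\<Prod>?S) > 0" using pos by (simp add: prod_pos del: of_nat_prod)
    ultimately show ?thesis by (subst ln_le_cancel_iff) auto
  qed
  also have "\<dots> = real n * ln 432" by (simp add: ln_realpow)
  finally show ?thesis .
qed

section \<open>Rational bounds for logarithms\<close>

lemma exp_1_bounds: "2718 \<le> 1000 * exp (1::real)" "1000 * exp (1::real) \<le> 2719"
  using e_approx_32 unfolding abs_le_iff by (simp_all add: field_simps)

text \<open>a/b \<le> ln x means e^a \<le> x^b. Replacing e by 2719/1000 leaves an inequality that
  can be evaluated when \<open>x\<close> is a numeral.\<close>

lemma ln_ge_fracI:
  fixes x :: real
  assumes "2719 ^ a \<le> 1000 ^ a * x ^ b" "x > 0" "b > 0"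
  shows "real a / real b \<le> ln x"
proof -
  have "real a = ln (exp 1 ^ a)" by (simp add: ln_realpow)
  also have "\<dots> \<le> ln (x ^ b)"
  proof (rule ln_mono)
    have "(1000 * exp (1::real)) ^ a \<le> 2719 ^ a" by (intro power_mono exp_1_bounds) simp
    also note assms(1)
    finally have "1000 ^ a * exp 1 ^ a \<le> 1000 ^ a * x ^ b" by (simp only: power_mult_distrib)
    then show "exp 1 ^ a \<le> x ^ b" by simp
  qed simp_all
  also have "\<dots> = real b * ln x" using assms by (simp add: ln_realpow)
  finally show ?thesis using assms by (simp add: field_simps)
qed

lemma ln_le_fracI:
  fixes x :: real
  assumes "1000 ^ a * x ^ b \<le> 2718 ^ a" "x > 0" "b > 0"
  shows "ln x \<le> real a / real b"
proof -
  have "real b * ln x = ln (x ^ b)" using assms by (simp add: ln_realpow)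
  also have "\<dots> \<le> ln (exp 1 ^ a)"
  proof (rule ln_mono)
    have "2718 ^ a \<le> (1000 * exp (1::real)) ^ a" by (intro power_mono exp_1_bounds) simp
    with assms(1) have "1000 ^ a * x ^ b \<le> (1000 * exp 1) ^ a" by (rule order.trans)
    then have "1000 ^ a * x ^ b \<le> 1000 ^ a * exp 1 ^ a" by (simp only: power_mult_distrib)
    then show "x ^ b \<le> exp 1 ^ a" by simp
  qed (use assms in simp_all)
  also have "\<dots> = real a" by (simp add: ln_realpow)
  finally show ?thesis using assms by (simp add: field_simps)
qed

lemma ln_numeric_bounds:
  shows "ln 432 \<le> (85 / 14 :: real)"
    and "36 / 5 \<le> ln (1400 :: real)" and "ln 1400 \<le> (29 / 4 :: real)"
    and "149 / 10 \<le> ln (3000000 :: real)" and "ln 3000000 \<le> (15 :: real)"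
    and "16 \<le> ln (9699690 :: real)"
  using ln_le_fracI[of 85 432 14, simplified] ln_ge_fracI[of 36 1400 5, simplified]
    ln_le_fracI[of 29 1400 4, simplified] ln_ge_fracI[of 149 3000000 10, simplified]
    ln_le_fracI[of 15 3000000 1, simplified] ln_ge_fracI[of 16 9699690 1, simplified]
  by (simp_all only:)

section \<open>Linear bound for Chebyshev's function\<close>

text \<open>Repeated division by 6 yields the slope ln 432 / 5 \<le> 17/14 < 61/50. From 1400 on,
  the slack in the slope absorbs the rounding.\<close>

lemma theta_le: "theta x \<le> 61 / 50 * real x + 10150"
proof (induction x rule: less_induct)
  case (less x)
  show ?case
  proof (cases "x < 1400")
    case True
    then have "theta x \<le> theta 1400" by (intro theta_mono) simp
    also have "\<dots> \<le> 1400 * ln 1400" using theta_le_trivial[of 1400] by simp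
    also have "\<dots> \<le> 10150" using ln_numeric_bounds(3) by simp
    finally show ?thesis by simp
  next
    case False
    \<comment> \<open>This is x/6 rounded up, so that 6n reaches \<open>x\<close>.\<close>
    define n where "n = (x + 5) div 6"
    have n: "x \<le> 6 * n" "6 * n \<le> x + 5" "n < x" using False unfolding n_def by linarith+
    have "theta x \<le> theta (6 * n)" using n(1) by (rule theta_mono)
    also have "\<dots> \<le> theta n + real n * ln 432" using theta_6_diff_le[of n] by simp
    also have "\<dots> \<le> (61 / 50 * real n + 10150) + real n * (85 / 14)"
      using less.IH[OF n(3)] ln_numeric_bounds(1) by (intro add_mono mult_left_mono) auto
    also have "\<dots> \<le> 61 / 50 * real x + 10150" using n(2) False by linarith
    finally show ?thesis .
  qed
qed

section \<open>From Chebyshev's function to the number of primes\<close>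

text \<open>t / (ln t - 6/5) serves as an elementary majorant of the logarithmic integral. With u =
  ln t - 6/5, its derivative (u - 1)/u^2 is at least 1/(u + 6/5) exactly when u \<ge> 6, that is ln
  t \<ge> 36/5.\<close>

lemma inverse_ln_le_diff:
  fixes x :: real
  assumes "36 / 5 \<le> ln x" "x > 0"
  shows "1 / ln (x + 1) \<le> (x + 1) / (ln (x + 1) - 6 / 5) - x / (ln x - 6 / 5)"
proof -
  have ln_ge: "36 / 5 \<le> ln t" if "x \<le> t" for t
    using assms that by (meson ln_mono order_trans less_le_trans)
  have der: "((\<lambda>t. t / (ln t - 6 / 5)) has_real_derivative
      (ln t - 6 / 5 - 1) / (ln t - 6 / 5)^2) (at t)" if "x \<le> t" for t
    using ln_ge[OF that] assms(2) that
    by (auto intro!: derivative_eq_intros simp: power2_eq_square)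
  obtain z where z: "x < z" "z < x + 1"
    "(x + 1) / (ln (x + 1) - 6 / 5) - x / (ln x - 6 / 5) = (x + 1 - x) * ((ln z - 6 / 5 - 1) / (ln z - 6 / 5)^2)"
    using MVT2[of x "x + 1" "\<lambda>t. t / (ln t - 6 / 5)"] der by force
  have lz: "36 / 5 \<le> ln z" using ln_ge z by simp
  moreover have "0 < z" using z assms by simp
  ultimately have "1 < z" by (simp flip: ln_gt_zero_iff)
  then have "1 / ln (x + 1) \<le> 1 / ln z"
    using lz z assms by (intro divide_left_mono mult_pos_pos) (auto intro!: ln_mono)
  also have "\<dots> \<le> (ln z - 6 / 5 - 1) / (ln z - 6 / 5)^2"
  proof -
    have "(ln z - 6 / 5)^2 \<le> (ln z - 6 / 5 - 1) * ln z"
      using lz by (simp add: power2_eq_square algebra_simps)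
    moreover have "0 < ln z" "0 < (ln z - 6 / 5)^2" using lz by auto
    ultimately show ?thesis by (simp only: pos_divide_le_eq pos_le_divide_eq times_divide_eq_left mult_1)
  qed
  finally show ?thesis using z by simp
qed

text \<open>
  Abel summation as a single induction: on passing from \<open>x\<close> to \<open>x + 1\<close>, a new prime contributes
  \<open>1 - ln (x + 1) / ln (x + 1) = 0\<close> to the left-hand side.
  The constant \<open>10150\<close> is \<open>1400 \<cdot> 29/4\<close>, and \<open>2810\<close> exceeds \<open>1400 + 10150 / (36/5)\<close>.
\<close>
lemma card_primes_upto_smoothed:
  assumes "1400 \<le> x"
  shows "real (card (primes_upto x)) - (theta x - 61 / 50 * real x - 10150) / ln (real x)
    \<le> 61 / 50 * (real x / (ln (real x) - 6 / 5)) + 2810"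
  using assms
proof (induction x rule: dec_induct)
  case base
  have L: "36 / 5 \<le> ln (1400::real)" by (rule ln_numeric_bounds)
  have "0 \<le> theta 1400" unfolding theta_def
    by (intro sum_nonneg ln_ge_zero) (auto simp: primes_upto_def prime_ge_Suc_0_nat)
  then have "- ((theta 1400 - 61 / 50 * 1400 - 10150) / ln 1400) \<le> (61 / 50 * 1400 + 10150) / ln (1400::real)"
    unfolding minus_divide_left using L by (intro divide_right_mono) auto
  also have "\<dots> = 61 / 50 * (1400 / ln 1400) + 10150 / ln 1400" by (simp add: add_divide_distrib)
  also have "\<dots> \<le> 61 / 50 * (1400 / (ln 1400 - 6 / 5)) + 10150 / (36 / 5)"
    using L by (intro add_mono mult_left_mono divide_left_mono mult_pos_pos) auto
  finally have "- ((theta 1400 - 61 / 50 * 1400 - 10150) / ln 1400)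
    \<le> 61 / 50 * (1400 / (ln 1400 - 6 / 5)) + 10150 / (36 / 5)" .
  then show ?case using card_primes_upto_le[of 1400] by simp
next
  case (step x)
  \<comment> \<open>Since \<open>D\<close> is nonpositive, lowering ln (x + 1) to ln x in
    \<open>- D / ln (x + 1)\<close> can only increase it. The linear term of \<open>D\<close>
    supplies the extra 61/50 / ln (x + 1).\<close>
  define D where "D = theta x - 61 / 50 * real x - 10150"
  have D: "D \<le> 0" using theta_le[of x] by (simp add: D_def)
  have lx: "36 / 5 \<le> ln (real x)"
    using ln_numeric_bounds(2) step(1) by (intro order.trans[OF _ ln_mono[of 1400 "real x"]]) auto
  have mono: "ln (real x) \<le> ln (real x + 1)" using step(1) by (intro ln_mono) auto
  have "real (card (primes_upto (Suc x))) - (theta (Suc x) - 61 / 50 * real (Suc x) - 10150) / ln (real (Suc x))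
     = real (card (primes_upto x)) - D / ln (real x + 1) + 61 / 50 * (1 / ln (real x + 1))"
    using lx mono
    by (simp add: D_def theta_def primes_upto_Suc diff_divide_distrib add_divide_distrib add.commute[of 1])
  also have "\<dots> \<le> real (card (primes_upto x)) - D / ln (real x) + 61 / 50 * (1 / ln (real x + 1))"
  proof -
    have "- D / ln (real x + 1) \<le> - D / ln (real x)"
      using D lx mono step(1) by (intro divide_left_mono mult_pos_pos) auto
    then show ?thesis by simp
  qed
  also have "\<dots> \<le> (61 / 50 * (real x / (ln (real x) - 6 / 5)) + 2810)
      + 61 / 50 * ((real x + 1) / (ln (real x + 1) - 6 / 5) - real x / (ln (real x) - 6 / 5))"
    using step.IH inverse_ln_le_diff[OF lx] step(1) unfolding D_def
    by (intro add_mono mult_left_mono) auto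
  also have "\<dots> = 61 / 50 * (real (Suc x) / (ln (real (Suc x)) - 6 / 5)) + 2810"
    by (simp add: algebra_simps)
  finally show ?case .
qed

lemma card_primes_upto_bound:
  assumes "3000000 \<le> x"
  shows "real (card (primes_upto x)) \<le> 1344 / 1000 * (real x / ln (real x))"
proof -
  define L where "L = ln (real x)"
  have "ln 3000000 \<le> L" unfolding L_def using assms by (intro ln_mono) auto
  then have L: "149 / 10 \<le> L" using ln_numeric_bounds(4) by simp
  \<comment> \<open>The tangent of the logarithm at 3000000 makes the final comparison linear in
    \<open>x\<close>.\<close>
  have "ln (real x / 3000000) \<le> real x / 3000000 - 1"
    using assms by (intro ln_le_minus_one) auto
  then have up: "L \<le> real x / 3000000 - 1 + 15"
    using assms ln_numeric_bounds(5) unfolding L_def by (simp add: ln_div)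
  have "real (card (primes_upto x)) \<le> real (card (primes_upto x)) - (theta x - 61 / 50 * real x - 10150) / L"
    using theta_le[of x] L by (simp add: divide_nonpos_pos)
  also have "\<dots> \<le> 61 / 50 * (real x / (L - 6 / 5)) + 2810"
    using card_primes_upto_smoothed[of x] assms by (simp add: L_def)
  \<comment> \<open>L / (L - 6/5) decreases in \<open>L\<close> and equals 149/137 at L = 149/10. As
    61/50 * 149/137 < 1.327, the rest of 1.344 is left to absorb 2810.\<close>
  also have "real x / (L - 6 / 5) \<le> real x * (149 / 137) / L"
    using L mult_left_mono[OF L, of "real x"] by (simp add: field_simps)
  also have "61 / 50 * (real x * (149 / 137) / L) + 2810 \<le> 1344 / 1000 * (real x / L)"
    using L up assms by (simp add: field_simps)
  finally show ?thesis by (simp add: L_def)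
qed

section \<open>Extremal sets of primes and the totient\<close>

text \<open>Exchange argument: once the common primes are cancelled, those left on the side of
  \<open>primes_upto b\<close> are at most \<open>b\<close>, while those left in \<open>S\<close>
  exceed \<open>b\<close> and are at least as many.\<close>

lemma prod_primes_upto_le:
  assumes S: "finite S" "\<And>p. p \<in> S \<Longrightarrow> prime p" and card: "card (primes_upto b) \<le> card S" and "0 < b"
  shows "\<Prod>(primes_upto b) \<le> \<Prod>S"
proof -
  let ?T = "primes_upto b"
  have "card (?T - S) + card (?T \<inter> S) \<le> card (S - ?T) + card (?T \<inter> S)"
    using card card_Diff_subset_Int[of ?T S] card_Diff_subset_Int[of S ?T] S
      card_mono[of S "?T \<inter> S"] card_mono[of ?T "?T \<inter> S"] by (simp add: Int_commute)
  then have le: "card (?T - S) \<le> card (S - ?T)" by simp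
  have "\<Prod>(?T - S) \<le> (\<Prod>p\<in>?T - S. b)" by (intro prod_mono) (auto simp: primes_upto_def)
  also have "\<dots> \<le> b ^ card (S - ?T)" using le \<open>0 < b\<close> by (simp add: power_increasing)
  also have "\<dots> = (\<Prod>p\<in>S - ?T. b)" by simp
  also have "\<dots> \<le> \<Prod>(S - ?T)" using S by (intro prod_mono) (auto simp: primes_upto_def)
  finally have "\<Prod>(?T - S) * \<Prod>(?T \<inter> S) \<le> \<Prod>(S - ?T) * \<Prod>(?T \<inter> S)" by simp
  then show ?thesis using S prod.Int_Diff[of ?T "\<lambda>x. x" S] prod.Int_Diff[of S "\<lambda>x. x" ?T]
    by (simp add: mult.commute Int_commute)
qed

text \<open>The same exchange: 1 - 1/p increases with \<open>p\<close> and stays below 1, so smaller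
  primes and more of them both lower the product.\<close>

lemma prod_one_minus_inverse_primes_upto_le:
  assumes S: "finite S" "\<And>p. p \<in> S \<Longrightarrow> prime p" and card: "card S \<le> card (primes_upto b)" and "0 < b"
  shows "(\<Prod>p\<in>primes_upto b. 1 - 1 / real p) \<le> (\<Prod>p\<in>S. 1 - 1 / real p)"
proof -
  let ?T = "primes_upto b" and ?f = "\<lambda>p. 1 - 1 / real p"
  have f0: "0 \<le> ?f p" for p by (cases "p = 0") auto
  have fmono: "?f p \<le> ?f q" if "0 < p" "p \<le> q" for p q
    using that by (simp add: frac_le)
  have "card (S - ?T) + card (?T \<inter> S) \<le> card (?T - S) + card (?T \<inter> S)"
    using card card_Diff_subset_Int[of ?T S] card_Diff_subset_Int[of S ?T] S
      card_mono[of S "?T \<inter> S"] card_mono[of ?T "?T \<inter> S"] by (simp add: Int_commute)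
  then have le: "card (S - ?T) \<le> card (?T - S)" by simp
  have "(\<Prod>p\<in>?T - S. ?f p) \<le> (\<Prod>p\<in>?T - S. ?f b)"
    by (intro prod_mono conjI f0 fmono) (auto simp: primes_upto_def prime_gt_0_nat)
  also have "\<dots> \<le> ?f b ^ card (S - ?T)"
    using power_decreasing[OF le f0[of b]] by simp
  also have "\<dots> = (\<Prod>p\<in>S - ?T. ?f b)" by simp
  also have "\<dots> \<le> (\<Prod>p\<in>S - ?T. ?f p)"
    using S \<open>0 < b\<close> by (intro prod_mono conjI f0 fmono) (auto simp: primes_upto_def)
  finally have "prod ?f (?T - S) * prod ?f (?T \<inter> S) \<le> prod ?f (S - ?T) * prod ?f (?T \<inter> S)"
    by (intro mult_right_mono prod_nonneg ballI f0)
  then show ?thesis using S prod.Int_Diff[of ?T ?f S] prod.Int_Diff[of S ?f ?T]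
    by (simp add: mult.commute Int_commute)
qed

lemma primes_upto_17: "primes_upto 17 = {2, 3, 5, 7, 11, 13, 17}"
  and primes_upto_19: "primes_upto 19 = {2, 3, 5, 7, 11, 13, 17, 19}"
proof -
  have "primes_upto 17 = set (filter prime [2..<18])" "primes_upto 19 = set (filter prime [2..<20])"
    by (auto simp: primes_upto_def prime_ge_2_nat simp del: upt_rec_numeral)
  then show "primes_upto 17 = {2, 3, 5, 7, 11, 13, 17}"
    and "primes_upto 19 = {2, 3, 5, 7, 11, 13, 17, 19}"
    by (simp_all del: set_filter)
qed

text \<open>
  Removing the largest prime \<open>q\<close> decreases the left-hand side, because the remaining product is at
  most \<open>q\<close> to the power \<open>q - 1\<close>. Hence the eight smallest primes are the worst case.
\<close>
lemma prod_one_minus_inverse_times_ln_ge: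
  assumes "8 \<le> card S" and "\<And>p. p \<in> S \<Longrightarrow> prime p"
  shows "27 / 10 \<le> (\<Prod>p\<in>S. 1 - 1 / real p) * ln (real (\<Prod>S))"
proof -
  obtain k where "card S = 8 + k" using le_Suc_ex[OF assms(1)] by blast
  then show ?thesis using assms(2)
  proof (induction k arbitrary: S)
    case 0
    have fin: "finite S" using 0(1) by (intro card_ge_0_finite) simp
    \<comment> \<open>9699690 is the product of the primes up to 19, and 1658880 is its
      totient.\<close>
    have "1658880 / 9699690 \<le> (\<Prod>p\<in>S. 1 - 1 / real p)"
      using prod_one_minus_inverse_primes_upto_le[OF fin 0(2), of 19] 0(1) by (simp add: primes_upto_19)
    moreover have "9699690 \<le> \<Prod>S"
      using prod_primes_upto_le[OF fin 0(2), of 19] 0(1) by (simp add: primes_upto_19)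
    then have "ln 9699690 \<le> ln (real (\<Prod>S))"
      by (intro ln_mono) (simp_all del: of_nat_prod)
    then have "16 \<le> ln (real (\<Prod>S))" using ln_numeric_bounds(6) by linarith
    ultimately have "1658880 / 9699690 * 16 \<le> (\<Prod>p\<in>S. 1 - 1 / real p) * ln (real (\<Prod>S))"
      by (intro mult_mono) auto
    then show ?case by simp
  next
    case (Suc k)
    have fin: "finite S" using Suc.prems(1) by (intro card_ge_0_finite) simp
    define q where "q = Max S"
    define R where "R = S - {q}"
    have ne: "S \<noteq> {}" using Suc.prems(1) by auto
    have q: "q \<in> S" unfolding q_def using fin ne by (rule Max_in)
    then have q1: "q > 1" using Suc.prems prime_gt_1_nat by blast
    have S: "S = insert q R" "q \<notin> R" "finite R" using q fin by (auto simp: R_def)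
    then have cardR: "card R = 8 + k" using Suc.prems(1) by simp
    have Rlt: "p < q" if "p \<in> R" for p
      using that fin by (auto simp: R_def q_def intro: le_neq_implies_less)
    have R0: "0 < p" if "p \<in> R" for p
      using that Suc.prems prime_gt_0_nat by (auto simp: R_def)
    have "R \<subseteq> {1..<q}" using Rlt R0 by force
    from card_mono[OF _ this] have cR: "real (card R) \<le> real q - 1" using q1 by simp
    define A where "A = ln (real (\<Prod>R))"
    have "A = (\<Sum>p\<in>R. ln (real p))"
      unfolding A_def of_nat_prod using S R0 by (intro ln_prod) auto
    also have "\<dots> \<le> (\<Sum>p\<in>R. ln (real q))"
      using Rlt R0 by (intro sum_mono ln_mono) (auto intro: less_imp_le)
    also have "\<dots> = real (card R) * ln (real q)" by simp
    also have "\<dots> \<le> (real q - 1) * ln (real q)" using cR q1 by (intro mult_right_mono) auto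
    finally have A: "A \<le> (real q - 1) * ln (real q)" .
    have "27 / 10 \<le> (\<Prod>p\<in>R. 1 - 1 / real p) * A"
      unfolding A_def using Suc.IH[of R] cardR Suc.prems S by auto
    \<comment> \<open>Multiplied out, A \<le> (1 - 1/q)(A + ln q) is just A \<le> (q - 1) ln
      q.\<close>
    also have "\<dots> \<le> (\<Prod>p\<in>R. 1 - 1 / real p) * ((1 - 1 / real q) * (A + ln (real q)))"
      using A q1 R0
      by (intro mult_left_mono prod_nonneg) (auto simp: field_simps Suc_leI)
    also have "A + ln (real q) = ln (real (\<Prod>S))"
    proof -
      have "0 < \<Prod>R" using R0 by (intro prod_pos) auto
      then have "ln (real q * real (\<Prod>R)) = ln (real q) + A"
        unfolding A_def using q1 by (intro ln_mult_pos) (auto simp del: of_nat_prod)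
      then show ?thesis using S by simp
    qed
    finally show ?case using S by (simp add: mult_ac)
  qed
qed

lemma totient_ge:
  assumes "3000000 \<le> n"
  shows "2689 / 1000 * (real n / ln (real n)) \<le> real (totient n)"
proof -
  let ?S = "prime_factors n" and ?g = "\<Prod>p\<in>prime_factors n. 1 - 1 / real p"
  have pr: "\<And>p. p \<in> ?S \<Longrightarrow> prime p" by auto
  have "ln 3000000 \<le> ln (real n)" using assms by (intro ln_mono) auto
  then have L: "149 / 10 \<le> ln (real n)" using ln_numeric_bounds(4) by simp
  have "2689 / 1000 \<le> ?g * ln (real n)"
  proof (cases "card ?S \<le> 7")
    case True
    \<comment> \<open>510510 is the product of the primes up to 17, with totient 92160; multiplied
      by 149/10 the ratio is just above 2.689.\<close>
    then have "92160 / 510510 \<le> ?g"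
      using prod_one_minus_inverse_primes_upto_le[OF _ pr, where b = 17] by (simp add: primes_upto_17)
    then have "92160 / 510510 * (149 / 10) \<le> ?g * ln (real n)" using L by (intro mult_mono) auto
    then show ?thesis by simp
  next
    case False
    have "\<Prod>?S dvd n" by (rule prod_primes_dvd) auto
    then have le: "\<Prod>?S \<le> n" using assms by (intro dvd_imp_le) auto
    have pos: "0 < \<Prod>?S" by (intro prod_pos ballI prime_gt_0_nat pr)
    have "27 / 10 \<le> ?g * ln (real (\<Prod>?S))"
      using False by (intro prod_one_minus_inverse_times_ln_ge) auto
    also have "\<dots> \<le> ?g * ln (real n)"
      using le pos by (intro mult_left_mono ln_mono prod_nonneg)
        (auto simp: Suc_leI prime_gt_0_nat simp del: of_nat_prod)
    finally show ?thesis by simp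
  qed
  then have "2689 / 1000 * (real n / ln (real n)) \<le> ?g * ln (real n) * (real n / ln (real n))"
    using L by (intro mult_right_mono) auto
  then show ?thesis using L by (simp add: totient_formula2 mult.commute)
qed

section \<open>Counting the totatives\<close>

theorem theorem2:
  fixes N :: nat
  assumes "N > 0" and "2 * N \<ge> 3000000"
  shows "card (X_set N) > card (P_set N)"
proof -
  define n where "n = 2 * N"
  have n: "3000000 \<le> n" using assms by (simp add: n_def)
  have "0 < ln (real n)" using n by simp
  \<comment> \<open>The margin is 2.688 < 2.689.\<close>
  then have "1344 / 1000 * (real n / ln (real n)) * 2 < 2689 / 1000 * (real n / ln (real n))"
    using n by (simp add: field_simps)
  then have lt: "2 * card (primes_upto n) < totient n"
    using card_primes_upto_bound[OF n] totient_ge[OF n] by linarith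
  have finP: "finite (P_set N)" and finX: "finite (X_set N)"
    by (rule finite_subset[of _ "{..2 * N}"]; force simp: P_set_def X_set_def)+
  \<comment> \<open>Counted twice, the prime 2 pays for the totatives 1 and n - 1 in the final
    count.\<close>
  have "insert 2 (P_set N) \<subseteq> primes_upto n" "2 \<notin> P_set N"
    using n by (auto simp: P_set_def primes_upto_def n_def)
  then have P: "Suc (card (P_set N)) \<le> card (primes_upto n)"
    using finP card_mono[of "primes_upto n" "insert 2 (P_set N)"] by simp
  have "totatives n \<subseteq> {1, n - 1} \<union> (X_set N \<union> P_set N)"
  proof
    fix x assume x: "x \<in> totatives n"
    then have cop: "coprime x n" and "0 < x" by (auto simp: in_totatives_iff)
    have "x < n" using totatives_less[OF x] n by simp
    \<comment> \<open>Both sets stop strictly below n - 2, which is even like \<open>n\<close> and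
      hence no totative.\<close>
    have "x \<noteq> n - 2"
    proof
      assume "x = n - 2"
      then have "2 dvd x" "2 dvd n" by (auto simp: n_def)
      then show False using cop coprime_common_divisor_nat by fastforce
    qed
    show "x \<in> {1, n - 1} \<union> (X_set N \<union> P_set N)"
    proof (cases "x = 1 \<or> x = n - 1")
      case False
      then have bd: "1 < x" "x < 2 * N - 2" using \<open>x < n\<close> \<open>x \<noteq> n - 2\<close> \<open>0 < x\<close> by (auto simp: n_def)
      have "p \<in> P_set N" if "prime p" "p dvd x" for p
      proof -
        have "p \<le> x" using that bd by (intro dvd_imp_le) auto
        moreover have "\<not> p dvd n" using that cop coprime_common_divisor not_prime_unit by blast
        ultimately show ?thesis using that bd by (simp add: P_set_def n_def)
      qed
      then show ?thesis using bd by (auto simp: X_set_def)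
    qed auto
  qed
  then have "totient n \<le> card ({1, n - 1} \<union> (X_set N \<union> P_set N))"
    unfolding totient_def using finP finX by (intro card_mono) auto
  also have "\<dots> \<le> card {1, n - 1} + (card (X_set N) + card (P_set N))"
    by (intro order.trans[OF card_Un_le] add_mono card_Un_le order.refl)
  also have "\<dots> \<le> 2 + (card (X_set N) + card (P_set N))" by (simp add: card_insert_if)
  finally show ?thesis using lt P by linarith
qed

end
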